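(* Let $\Gamma=(G,\sigma)$ be a signed graph with at least one edge. Then \begin{align*} \lambda_N(L^{\sigma})\leq \frac{1}{2}\max_{u\sim v}\Big\{&d_u+d_v+\sum_{u':\,u'\sim u,\ u'\not\sim v}w_{u'u}+\sum_{\substack{u':\,u'\sim u,\ u'\sim v\\ \sigma(u'u)\sigma(u'v)=-\sigma(uv)}}w_{u'u}\\ &+\sum_{u':\,u'\sim v,\ u'\not\sim u}w_{u'v}+\sum_{\substack{u':\,u'\sim u,\ u'\sim v\\ \sigma(u'u)\sigma(u'v)=-\sigma(uv)}}w_{u'v}+\sum_{\substack{u':\,u'\sim u,\ u'\sim v\\ \sigma(u'u)\sigma(u'v)=\sigma(uv)}}|w_{u'u}-w_{u'v}|\Big\}. \end{align*}
   Context: A signed graph $\Gamma=(G,\sigma)$ consists of a finite simple undirected graph $G=(V,E)$ with $N=|V|$ vertices, positive symmetric edge weights $w_{uv}>0$ for $\{u,v\}\in E$ ($w_{uv}=0$ otherwise), and a signature $\sigma:E\to\{+1,-1\}$; write $\sigma(uv)=\sigma(\{u,v\})$ and $u\sim v$ if $\{u,v\}\in E$. The degree is $d_u=\sum_v w_{uv}$, $D=\mathrm{diag}(d_u)$, $A^{\sigma}_{uv}=\sigma(uv)w_{uv}$ for edges and $0$ otherwise, and $L^\sigma=D-A^\sigma$ with largest eigenvalue $\lambda_N(L^\sigma)$. In the sums over $u'$ with $u'\sim u$, $u'\not\sim v$, the vertex $u'=v$ is included (since $v\not\sim v$), and similarly with $u,v$ exchanged. *)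

theory Defs
  imports "HOL-Analysis.Analysis"
begin

text \<open>
  The vertex set is the whole of a finite type, so that matrices indexed by vertices are matrices
  of type \<open>real ^ 'v ^ 'v\<close>. Edges are two-element sets of vertices, so
  \<open>u \<sim> v\<close> reads \<open>{u, v} \<in> E\<close>; in particular no vertex is adjacent to itself.
  The values of the signature outside \<open>E\<close> are irrelevant.
\<close>

locale signed_graph =
  fixes E :: "'v::finite set set"
    and w :: "'v \<Rightarrow> 'v \<Rightarrow> real"
    and \<sigma> :: "'v set \<Rightarrow> real"
  assumes card_edge: "e \<in> E \<Longrightarrow> card e = 2"
    and weight_sym: "w u v = w v u"
    and weight_pos: "{u, v} \<in> E \<Longrightarrow> w u v > 0"
    and weight_nonedge: "{u, v} \<notin> E \<Longrightarrow> w u v = 0"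
    and signature: "e \<in> E \<Longrightarrow> \<sigma> e \<in> {1, -1}"

definition vertex_degree :: "('v::finite \<Rightarrow> 'v \<Rightarrow> real) \<Rightarrow> 'v \<Rightarrow> real" where
  "vertex_degree w u = (\<Sum>v\<in>UNIV. w u v)"

definition degree_matrix :: "('v::finite \<Rightarrow> 'v \<Rightarrow> real) \<Rightarrow> real ^ 'v ^ 'v" where
  "degree_matrix w = (\<chi> u v. if u = v then vertex_degree w u else 0)"

definition signed_adjacency ::
  "'v::finite set set \<Rightarrow> ('v \<Rightarrow> 'v \<Rightarrow> real) \<Rightarrow> ('v set \<Rightarrow> real) \<Rightarrow> real ^ 'v ^ 'v" where
  "signed_adjacency E w \<sigma> = (\<chi> u v. if {u, v} \<in> E then \<sigma> {u, v} * w u v else 0)"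

definition signed_laplacian ::
  "'v::finite set set \<Rightarrow> ('v \<Rightarrow> 'v \<Rightarrow> real) \<Rightarrow> ('v set \<Rightarrow> real) \<Rightarrow> real ^ 'v ^ 'v" where
  "signed_laplacian E w \<sigma> = degree_matrix w - signed_adjacency E w \<sigma>"

definition eigenvalue :: "real ^ 'n ^ 'n \<Rightarrow> real \<Rightarrow> bool" where
  "eigenvalue M k \<longleftrightarrow> (\<exists>x. x \<noteq> 0 \<and> M *v x = k *\<^sub>R x)"

text \<open>Only meaningful for matrices with at least one real eigenvalue, such as symmetric ones.\<close>

definition largest_eigenvalue :: "real ^ 'n ^ 'n \<Rightarrow> real" where
  "largest_eigenvalue M = Max {k. eigenvalue M k}"

end

theory Submission
  imports Defs
begin

text \<open>
  Let \<open>x\<close> be an eigenvector for \<open>k\<close>, and let \<open>{u, v}\<close> be an edge maximising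
  \<open>m = \<bar>x\<^sub>u - \<sigma>(uv) x\<^sub>v\<bar>\<close>; replacing \<open>x\<close> by \<open>-x\<close>, assume
  \<open>m = x\<^sub>u - \<sigma>(uv) x\<^sub>v\<close>. Subtracting \<open>\<sigma>(uv)\<close> times row \<open>v\<close> of the eigenvalue equation
  from row \<open>u\<close> writes \<open>k * m\<close> as a sum over all vertices \<open>u'\<close>, and each summand is at most
  \<open>m / 2\<close> times the contribution of \<open>u'\<close> to the bound. The interesting case is a balanced
  triangle \<open>u, v, u'\<close>: there \<open>p = x\<^sub>u - \<sigma>(u'u) x\<^sub>u\<^sub>'\<close> and
  \<open>q = \<sigma>(uv) (x\<^sub>v - \<sigma>(u'v) x\<^sub>u\<^sub>')\<close> satisfy \<open>p - q = m\<close>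
  and \<open>\<bar>p\<bar>, \<bar>q\<bar> \<le> m\<close>, so for \<open>\<alpha>, \<beta>\<close> the weights of the edges at \<open>u'\<close>,
  \<open>\<alpha> p - \<beta> q \<le> max \<alpha> \<beta> * m\<close>.
  If \<open>m = 0\<close> then \<open>k = 0\<close>.
\<close>

section \<open>Spectra of real symmetric matrices\<close>

lemma symmetric_matrix_inner:
  fixes A :: "real ^ 'n ^ 'n"
  assumes "transpose A = A"
  shows "(A *v x) \<bullet> y = x \<bullet> (A *v y)"
  by (metis assms dot_lmul_matrix transpose_matrix_vector)

text \<open>Eigenvectors for distinct eigenvalues are orthogonal, and Euclidean space has no
  infinite set of pairwise orthogonal vectors. Needed for \<open>Max\<close> in
  \<open>largest_eigenvalue\<close> to be meaningful.\<close>

lemma finite_eigenvalues_symmetric: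
  fixes A :: "real ^ 'n ^ 'n"
  assumes sym: "transpose A = A"
  shows "finite {k. eigenvalue A k}"
proof -
  have "\<forall>k. \<exists>x. eigenvalue A k \<longrightarrow> x \<noteq> 0 \<and> A *v x = k *\<^sub>R x"
    unfolding eigenvalue_def by blast
  then obtain f where f: "\<And>k. eigenvalue A k \<Longrightarrow> f k \<noteq> 0 \<and> A *v f k = k *\<^sub>R f k"
    by metis
  let ?K = "{k. eigenvalue A k}"
  have inj: "inj_on f ?K"
  proof (rule inj_onI)
    fix k l assume "k \<in> ?K" "l \<in> ?K" "f k = f l"
    then show "k = l"
      using f[of k] f[of l] by (metis mem_Collect_eq scaleR_right_imp_eq)
  qed
  have orth: "f k \<bullet> f l = 0" if "eigenvalue A k" "eigenvalue A l" "k \<noteq> l" for k l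
  proof -
    have "k * (f k \<bullet> f l) = l * (f k \<bullet> f l)"
      using symmetric_matrix_inner[OF sym, of "f k" "f l"] f[OF that(1)] f[OF that(2)] by simp
    then show ?thesis using \<open>k \<noteq> l\<close> by simp
  qed
  have "pairwise orthogonal (f ` ?K)"
    using orth by (auto simp: pairwise_def orthogonal_def)
  then have "finite (f ` ?K)"
    using pairwise_orthogonal_imp_finite by blast
  then show ?thesis using inj finite_imageD by blast
qed

text \<open>The Rayleigh quotient attains its maximum on the compact unit sphere, and any maximiser
  is an eigenvector.\<close>

lemma symmetric_matrix_has_eigenvalue:
  fixes A :: "real ^ 'n ^ 'n"
  assumes sym: "transpose A = A"
  shows "\<exists>k. eigenvalue A k"
proof -
  have "continuous_on (sphere 0 1) (\<lambda>x. x \<bullet> (A *v x))"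
    by (intro continuous_intros matrix_vector_mult_linear_continuous_on)
  moreover have "sphere (0 :: real ^ 'n) 1 \<noteq> {}" by simp
  ultimately obtain x where x: "norm x = 1"
    and xmax: "\<And>y. norm y = 1 \<Longrightarrow> y \<bullet> (A *v y) \<le> x \<bullet> (A *v x)"
    using continuous_attains_sup[OF compact_sphere, of 0 1 "\<lambda>x. x \<bullet> (A *v x)"] by auto
  define k where "k = x \<bullet> (A *v x)"
  \<comment> \<open>The quadratic form of \<open>k I - A\<close>: nonnegative because
    \<open>k\<close> is the maximum, and zero at \<open>x\<close>.\<close>
  define q where "q y = k * (y \<bullet> y) - y \<bullet> (A *v y)" for y
  have q_nonneg: "q y \<ge> 0" for y
  proof (cases "y = 0")
    case False
    have "(y /\<^sub>R norm y) \<bullet> (A *v (y /\<^sub>R norm y)) \<le> k"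
      unfolding k_def using False by (intro xmax) simp
    then have "(y \<bullet> (A *v y)) / (norm y)\<^sup>2 \<le> k"
      by (simp add: matrix_vector_mult_scaleR power2_eq_square divide_inverse mult_ac)
    then show ?thesis
      using False by (simp add: q_def field_simps power2_norm_eq_inner)
  qed (simp add: q_def)
  have qx: "q x = 0" using x by (simp add: q_def k_def norm_eq_1)
  \<comment> \<open>Half the gradient of \<open>q\<close> at \<open>x\<close>; it must vanish, as
    \<open>x\<close> minimises \<open>q\<close>.\<close>
  define r where "r = k *\<^sub>R x - A *v x"
  have q_line: "q (x + t *\<^sub>R r) = t * (2 * (r \<bullet> r) + t * q r)" for t
  proof -
    have "q (x + t *\<^sub>R r) = q x + 2 * t * (r \<bullet> (k *\<^sub>R x - A *v x)) + t * t * q r"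
      using symmetric_matrix_inner[OF sym, of r x]
      by (simp add: q_def matrix_vector_right_distrib matrix_vector_mult_scaleR
          inner_add_left inner_add_right inner_diff_right inner_commute algebra_simps)
    then show ?thesis using qx by (simp add: r_def[symmetric] algebra_simps)
  qed
  have "r = 0"
  proof (rule ccontr)
    assume "r \<noteq> 0"
    then have pos: "r \<bullet> r > 0" by simp
    \<comment> \<open>A step against the gradient, short enough that the linear term of
      \<open>q_line\<close> beats the quadratic one. The \<open>+ 1\<close> keeps the denominator
      positive when \<open>q r = 0\<close>.\<close>
    define t where "t = (r \<bullet> r) / (q r + 1)"
    have "t > 0" using pos q_nonneg[of r] by (simp add: t_def)
    have "t * q r \<le> r \<bullet> r"
      using pos q_nonneg[of r] by (simp add: t_def field_simps)
    with pos have "0 < 2 * (r \<bullet> r) - t * q r" by linarith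
    then have "0 < t * (2 * (r \<bullet> r) - t * q r)" using \<open>t > 0\<close> by simp
    then show False
      using q_line[of "- t"] q_nonneg[of "x + (- t) *\<^sub>R r"] by simp
  qed
  moreover have "x \<noteq> 0" using x by auto
  ultimately show ?thesis
    unfolding eigenvalue_def r_def by (metis eq_iff_diff_eq_0)
qed

lemma weighted_difference_le:
  fixes \<alpha> \<beta> p q m :: real
  assumes "p - q = m" "\<bar>p\<bar> \<le> m" "\<bar>q\<bar> \<le> m"
  shows "\<alpha> * p - \<beta> * q \<le> m / 2 * (\<alpha> + \<beta> + \<bar>\<alpha> - \<beta>\<bar>)"
proof -
  \<comment> \<open>The hypotheses force p \<ge> 0 and q \<le> 0, so raising both coefficients to
    their maximum can only increase the terms.\<close>
  have "\<alpha> * p \<le> max \<alpha> \<beta> * p" "\<beta> * (- q) \<le> max \<alpha> \<beta> * (- q)"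
    using assms by (intro mult_right_mono; simp)+
  then have "\<alpha> * p - \<beta> * q \<le> max \<alpha> \<beta> * m"
    using assms(1) by (simp add: algebra_simps)
  also have "max \<alpha> \<beta> = (\<alpha> + \<beta> + \<bar>\<alpha> - \<beta>\<bar>) / 2" by simp
  finally show ?thesis by (simp add: mult_ac)
qed

text \<open>Spelled exactly as in the theorem, so that unfolding it closes the final goal.\<close>

definition edge_bound ::
  "'v::finite set set \<Rightarrow> ('v \<Rightarrow> 'v \<Rightarrow> real) \<Rightarrow> ('v set \<Rightarrow> real) \<Rightarrow> 'v \<Rightarrow> 'v \<Rightarrow> real" where
  "edge_bound E w \<sigma> u v = vertex_degree w u + vertex_degree w v
      + (\<Sum>u' | {u', u} \<in> E \<and> {u', v} \<notin> E. w u' u)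
      + (\<Sum>u' | {u', u} \<in> E \<and> {u', v} \<in> E \<and> \<sigma> {u', u} * \<sigma> {u', v} = - \<sigma> {u, v}. w u' u)
      + (\<Sum>u' | {u', v} \<in> E \<and> {u', u} \<notin> E. w u' v)
      + (\<Sum>u' | {u', u} \<in> E \<and> {u', v} \<in> E \<and> \<sigma> {u', u} * \<sigma> {u', v} = - \<sigma> {u, v}. w u' v)
      + (\<Sum>u' | {u', u} \<in> E \<and> {u', v} \<in> E \<and> \<sigma> {u', u} * \<sigma> {u', v} = \<sigma> {u, v}. \<bar>w u' u - w u' v\<bar>)"

section \<open>Rows of the signed Laplacian and the edge bound as sums over all vertices\<close>

context signed_graph
begin

lemma weight_nonneg: "w u v \<ge> 0"
  using weight_pos[of u v] weight_nonedge[of u v] by (cases "{u, v} \<in> E") auto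

text \<open>Serves the degenerate case in which all edge differences vanish and the eigenvalue is
  0.\<close>

lemma edge_bound_nonneg: "edge_bound E w \<sigma> u v \<ge> 0"
  unfolding edge_bound_def vertex_degree_def
  by (intro add_nonneg_nonneg sum_nonneg) (auto simp: weight_nonneg)

lemma transpose_signed_laplacian:
  "transpose (signed_laplacian E w \<sigma>) = signed_laplacian E w \<sigma>"
  by (simp add: signed_laplacian_def degree_matrix_def signed_adjacency_def transpose_def vec_eq_iff
      insert_commute weight_sym)

text \<open>Spreading the degree over the sum leaves only edge differences; off the edges the weight
  is 0, so the arbitrary values of \<sigma> there do no harm.\<close>

lemma signed_laplacian_mult:
  "(signed_laplacian E w \<sigma> *v x) $ u = (\<Sum>u'\<in>UNIV. w u' u * (x $ u - \<sigma> {u', u} * x $ u'))"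
proof -
  have "(signed_laplacian E w \<sigma> *v x) $ u =
    (\<Sum>u'\<in>UNIV. (if u = u' then vertex_degree w u * x $ u' else 0) - w u' u * \<sigma> {u', u} * x $ u')"
    unfolding signed_laplacian_def degree_matrix_def signed_adjacency_def matrix_vector_mult_def
    by (auto intro!: sum.cong simp: insert_commute weight_nonedge weight_sym[of u] algebra_simps)
  also have "\<dots> = vertex_degree w u * x $ u - (\<Sum>u'\<in>UNIV. w u' u * \<sigma> {u', u} * x $ u')"
    by (simp add: sum_subtractf)
  also have "\<dots> = (\<Sum>u'\<in>UNIV. w u' u * (x $ u - \<sigma> {u', u} * x $ u'))"
    by (simp add: vertex_degree_def sum_distrib_left sum_distrib_right sum_subtractf
        weight_sym[of u] algebra_simps)
  finally show ?thesis .
qed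

text \<open>Turning the filters into indicators gives one sum over \<open>UNIV\<close>, which can be
  compared with the row sums term by term.\<close>

lemma edge_bound_sum:
  "edge_bound E w \<sigma> u v = (\<Sum>u'\<in>UNIV. w u' u + w u' v
      + (if {u', u} \<in> E \<and> {u', v} \<notin> E then w u' u else 0)
      + (if {u', u} \<in> E \<and> {u', v} \<in> E \<and> \<sigma> {u', u} * \<sigma> {u', v} = - \<sigma> {u, v} then w u' u else 0)
      + (if {u', v} \<in> E \<and> {u', u} \<notin> E then w u' v else 0)
      + (if {u', u} \<in> E \<and> {u', v} \<in> E \<and> \<sigma> {u', u} * \<sigma> {u', v} = - \<sigma> {u, v} then w u' v else 0)
      + (if {u', u} \<in> E \<and> {u', v} \<in> E \<and> \<sigma> {u', u} * \<sigma> {u', v} = \<sigma> {u, v}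
          then \<bar>w u' u - w u' v\<bar> else 0))"
  unfolding edge_bound_def vertex_degree_def
  by (simp only: sum.distrib sum.inter_filter[OF finite, where A = UNIV, simplified])
    (simp add: weight_sym[of u] weight_sym[of v])

section \<open>Estimating an eigenvalue at an edge with the largest difference\<close>

lemma eigenvalue_le_edge_bound_at_maximal_edge:
  assumes eig: "signed_laplacian E w \<sigma> *v x = k *\<^sub>R x"
    and uv: "{u, v} \<in> E"
    and pos: "x $ u - \<sigma> {u, v} * x $ v > 0"
    and maximal: "\<And>a b. {a, b} \<in> E \<Longrightarrow> \<bar>x $ a - \<sigma> {a, b} * x $ b\<bar> \<le> x $ u - \<sigma> {u, v} * x $ v"
  shows "k \<le> 1 / 2 * edge_bound E w \<sigma> u v"
proof -
  define s where "s = \<sigma> {u, v}"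
  define m where "m = x $ u - s * x $ v"
  have s: "s = 1 \<or> s = - 1" using signature[OF uv] by (simp add: s_def)
  have row: "k * x $ a = (\<Sum>u'\<in>UNIV. w u' a * (x $ a - \<sigma> {u', a} * x $ u'))" for a
    using signed_laplacian_mult[of x a] eig by simp
  have "k * m = k * x $ u - s * (k * x $ v)" by (simp add: m_def algebra_simps)
  also have "\<dots> = (\<Sum>u'\<in>UNIV. w u' u * (x $ u - \<sigma> {u', u} * x $ u')
      - s * (w u' v * (x $ v - \<sigma> {u', v} * x $ u')))"
    unfolding row by (simp add: sum_subtractf sum_distrib_left)
  also have "\<dots> \<le> m / 2 * edge_bound E w \<sigma> u v"
    unfolding edge_bound_sum sum_distrib_left s_def[symmetric]
  proof (rule sum_mono)
    fix z :: 'v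
    define p where "p = x $ u - \<sigma> {z, u} * x $ z"
    \<comment> \<open>With the factor \<open>s\<close> included, the summand is
      \<open>w z u * p - w z v * q\<close>; as s is 1 or -1, it does not affect the absolute
      value.\<close>
    define q where "q = s * (x $ v - \<sigma> {z, v} * x $ z)"
    have p_le: "\<bar>p\<bar> \<le> m" if "{z, u} \<in> E"
      using maximal[of u z] that by (simp add: p_def m_def s_def insert_commute)
    have q_le: "\<bar>q\<bar> \<le> m" if "{z, v} \<in> E"
      using maximal[of v z] that s by (auto simp: q_def m_def s_def insert_commute abs_mult)
    have pw: "w z u * p \<le> w z u * m" if "{z, u} \<in> E"
      using p_le[OF that] by (intro mult_left_mono) (auto simp: weight_nonneg)
    have qw: "- (w z v * q) \<le> w z v * m" if "{z, v} \<in> E"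
      using mult_left_mono[of "- q" m "w z v"] q_le[OF that] by (auto simp: weight_nonneg)
    \<comment> \<open>In a balanced triangle the two \<open>x $ z\<close> terms have equal
      coefficients and cancel.\<close>
    have diff: "p - q = m" if "\<sigma> {z, u} * \<sigma> {z, v} = s" "{z, v} \<in> E"
    proof -
      have "\<sigma> {z, u} = s * \<sigma> {z, v}" using that signature[of "{z, v}"] by auto
      then show ?thesis using s by (auto simp: p_def q_def m_def algebra_simps)
    qed
    have s_cases: "\<sigma> {z, u} * \<sigma> {z, v} = s \<or> \<sigma> {z, u} * \<sigma> {z, v} = - s"
      if "{z, u} \<in> E" "{z, v} \<in> E"
      using signature[OF that(1)] signature[OF that(2)] s by auto
    have "w z u * p - w z v * q \<le> m / 2 * (w z u + w z v
      + (if {z, u} \<in> E \<and> {z, v} \<notin> E then w z u else 0)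
      + (if {z, u} \<in> E \<and> {z, v} \<in> E \<and> \<sigma> {z, u} * \<sigma> {z, v} = - s then w z u else 0)
      + (if {z, v} \<in> E \<and> {z, u} \<notin> E then w z v else 0)
      + (if {z, u} \<in> E \<and> {z, v} \<in> E \<and> \<sigma> {z, u} * \<sigma> {z, v} = - s then w z v else 0)
      + (if {z, u} \<in> E \<and> {z, v} \<in> E \<and> \<sigma> {z, u} * \<sigma> {z, v} = s then \<bar>w z u - w z v\<bar> else 0))"
      (is "_ \<le> ?rhs")
    proof (cases "{z, u} \<in> E \<and> {z, v} \<in> E")
      case True
      consider "\<sigma> {z, u} * \<sigma> {z, v} = s" | "\<sigma> {z, u} * \<sigma> {z, v} = - s"
        using s_cases True by blast
      then show ?thesis
      proof cases
        case 1
        have "w z u * p - w z v * q \<le> m / 2 * (w z u + w z v + \<bar>w z u - w z v\<bar>)"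
          using True 1 by (intro weighted_difference_le diff p_le q_le) auto
        also have "\<dots> = ?rhs" using True 1 s by auto
        finally show ?thesis .
      next
        case 2
        \<comment> \<open>In an unbalanced triangle each weight occurs twice in the bound, which
          absorbs the factor 1/2, so estimating \<open>p\<close> and \<open>q\<close> separately is
          enough.\<close>
        have "w z u * p - w z v * q \<le> w z u * m + w z v * m" using pw qw True by fastforce
        also have "\<dots> = ?rhs" using True 2 s by (auto simp: algebra_simps)
        finally show ?thesis .
      qed
    next
      case False
      \<comment> \<open>The weight of the only edge from \<open>z\<close>, if there is one, is again
        counted twice. The vertices \<open>u\<close> and \<open>v\<close> themselves fall under this
        case.\<close>
      then show ?thesis
        using pw qw weight_nonedge[of z u] weight_nonedge[of z v]
        by (cases "{z, u} \<in> E"; cases "{z, v} \<in> E") (auto simp: algebra_simps)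
    qed
    then show "w z u * (x $ u - \<sigma> {z, u} * x $ z) - s * (w z v * (x $ v - \<sigma> {z, v} * x $ z)) \<le> ?rhs"
      by (simp add: p_def q_def mult.left_commute)
  qed
  finally have "m * k \<le> m * (1 / 2 * edge_bound E w \<sigma> u v)" by (simp add: mult_ac)
  then show ?thesis using pos by (simp add: m_def s_def)
qed

lemma eigenvalue_le_edge_bound:
  assumes "E \<noteq> {}" and "eigenvalue (signed_laplacian E w \<sigma>) k"
  obtains u v where "{u, v} \<in> E" "k \<le> 1 / 2 * edge_bound E w \<sigma> u v"
proof -
  obtain x where x0: "x \<noteq> 0" and eig: "signed_laplacian E w \<sigma> *v x = k *\<^sub>R x"
    using assms(2) unfolding eigenvalue_def by blast
  define P where "P = {(a, b). {a, b} \<in> E}"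
  define g where "g = (\<lambda>(a, b). \<bar>x $ a - \<sigma> {a, b} * x $ b\<bar>)"
  obtain e where "e \<in> E" using \<open>E \<noteq> {}\<close> by blast
  then obtain a b where "{a, b} \<in> E" using card_edge by (metis card_2_iff)
  then have "P \<noteq> {}" by (auto simp: P_def)
  moreover have "finite P" by simp
  ultimately obtain u v where uv: "{u, v} \<in> E" and gmax: "Max (g ` P) = g (u, v)"
    using Max_in[of "g ` P"] unfolding P_def
    by (smt (verit) case_prodE finite_imageI imageE image_is_empty mem_Collect_eq)
  have maximal: "\<bar>x $ a - \<sigma> {a, b} * x $ b\<bar> \<le> \<bar>x $ u - \<sigma> {u, v} * x $ v\<bar>" if "{a, b} \<in> E" for a b
  proof -
    have "g (a, b) \<le> Max (g ` P)" using that by (intro Max_ge) (auto simp: P_def)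
    then show ?thesis unfolding gmax by (simp add: g_def)
  qed
  consider "x $ u - \<sigma> {u, v} * x $ v > 0" | "x $ u - \<sigma> {u, v} * x $ v < 0"
    | "x $ u - \<sigma> {u, v} * x $ v = 0" by linarith
  then have "k \<le> 1 / 2 * edge_bound E w \<sigma> u v"
  proof cases
    case 1
    then show ?thesis
      using maximal by (intro eigenvalue_le_edge_bound_at_maximal_edge[OF eig uv]) auto
  next
    case 2
    have eig': "signed_laplacian E w \<sigma> *v (- x) = k *\<^sub>R (- x)"
      using eig matrix_vector_mult_scaleR[of "signed_laplacian E w \<sigma>" "- 1" x] by simp
    show ?thesis
    proof (rule eigenvalue_le_edge_bound_at_maximal_edge[OF eig' uv])
      show "(- x) $ u - \<sigma> {u, v} * (- x) $ v > 0" using 2 by simp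
      show "\<bar>(- x) $ a - \<sigma> {a, b} * (- x) $ b\<bar> \<le> (- x) $ u - \<sigma> {u, v} * (- x) $ v"
        if "{a, b} \<in> E" for a b
        using maximal[OF that] 2 by simp
    qed
  next
    case 3
    \<comment> \<open>A maximal difference of 0 makes every summand of every row vanish, so
      \<open>x\<close> lies in the kernel.\<close>
    have "w b a * (x $ a - \<sigma> {b, a} * x $ b) = 0" for a b
      using maximal[of a b] 3 weight_nonedge[of b a] by (cases "{b, a} \<in> E") (auto simp: insert_commute)
    then have "signed_laplacian E w \<sigma> *v x = 0"
      by (simp only: vec_eq_iff signed_laplacian_mult) simp
    then have "k = 0" using eig x0 by simp
    then show ?thesis using edge_bound_nonneg by simp
  qed
  then show ?thesis using that uv by blast
qed

end

theorem theorem7p1: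
  fixes E :: "'v::finite set set"
    and w :: "'v \<Rightarrow> 'v \<Rightarrow> real"
    and \<sigma> :: "'v set \<Rightarrow> real"
  assumes "signed_graph E w \<sigma>"
    and "E \<noteq> {}"
  shows "largest_eigenvalue (signed_laplacian E w \<sigma>) \<le>
    1 / 2 * Max {vertex_degree w u + vertex_degree w v
      + (\<Sum>u' | {u', u} \<in> E \<and> {u', v} \<notin> E. w u' u)
      + (\<Sum>u' | {u', u} \<in> E \<and> {u', v} \<in> E \<and> \<sigma> {u', u} * \<sigma> {u', v} = - \<sigma> {u, v}. w u' u)
      + (\<Sum>u' | {u', v} \<in> E \<and> {u', u} \<notin> E. w u' v)
      + (\<Sum>u' | {u', u} \<in> E \<and> {u', v} \<in> E \<and> \<sigma> {u', u} * \<sigma> {u', v} = - \<sigma> {u, v}. w u' v)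
      + (\<Sum>u' | {u', u} \<in> E \<and> {u', v} \<in> E \<and> \<sigma> {u', u} * \<sigma> {u', v} = \<sigma> {u, v}. \<bar>w u' u - w u' v\<bar>)
      | u v. {u, v} \<in> E}"
proof -
  interpret signed_graph E w \<sigma> by fact
  let ?L = "signed_laplacian E w \<sigma>"
  let ?B = "{edge_bound E w \<sigma> u v | u v. {u, v} \<in> E}"
  have "?B \<subseteq> (\<lambda>(u, v). edge_bound E w \<sigma> u v) ` UNIV" by auto
  then have finB: "finite ?B" by (rule finite_subset) simp
  have "k \<le> 1 / 2 * Max ?B" if k: "eigenvalue ?L k" for k
  proof -
    obtain u v where "{u, v} \<in> E" and le: "k \<le> 1 / 2 * edge_bound E w \<sigma> u v"
      using eigenvalue_le_edge_bound[OF \<open>E \<noteq> {}\<close> k] .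
    then have "edge_bound E w \<sigma> u v \<le> Max ?B" using finB by (intro Max_ge) auto
    with le show ?thesis by simp
  qed
  \<comment> \<open>The set of eigenvalues is finite and nonempty, so bounding its
    \<open>Max\<close> reduces to bounding each eigenvalue.\<close>
  then have "Max {k. eigenvalue ?L k} \<le> 1 / 2 * Max ?B"
    using finite_eigenvalues_symmetric[OF transpose_signed_laplacian]
      symmetric_matrix_has_eigenvalue[OF transpose_signed_laplacian]
    by (subst Max_le_iff) auto
  then show ?thesis unfolding largest_eigenvalue_def edge_bound_def .
qed

end
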